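(* Let $k \ge 0$ be an integer, let $G$ be a graph on $n$ vertices and let $d_n \le \ldots \le d_1$ be its degree sequence. Let $B = \{0 \le d_n \le \ldots \le d_1 \le n-1\}$ and let $V_1, V_2, \ldots, V_t$ be the sets of vertices corresponding to the subsequences $B_1, B_2, \ldots, B_t$ given by Algorithm 2 under input $B$. Then $V_1 \cup V_2 \cup \ldots \cup V_t$ is a partition of $V(G)$ into $t = \Omega_k(G)$ $k$-large sets.
   Context: Graphs are finite and simple with nonempty vertex set; $n = |V(G)|$. A set $W \subseteq V(G)$ is $k$-large if $\deg(v) \ge |W| - k - 1$ for every $v \in W$. $\Omega_k(G)$ is the minimum integer $t$ such that $V(G)$ can be partitioned into $t$ $k$-large sets. The vertices of $G$ are ordered $v_1, \ldots, v_n$ so that $\deg(v_j) = d_j$ (here in non-increasing order of degree); the vertex set corresponding to a subsequence consisting of the entries $d_j$, $j \in J$, is $\{v_j : j \in J\}$ (entries of a sequence are distinguished by their indices). Algorithm 2 (input: a sequence $B = \{0 \le b_m \le b_{m-1} \le \ldots \le b_1 \le n-1\}$ of $m$ integers; here $m = n$ and $b_j = d_j$): Set $i := 0$ and $S_0 := B$. Repeat the following until $S_i = \emptyset$: (1) $n_i := |S_i|$; (2) $q_i := \min\{n_i,\, b_{n_i} + k + 1\}$; (3) $B_{i+1} := \{b_{n_i}, b_{n_i - 1}, \ldots, b_{n_i - q_i + 1}\}$; (4) $S_{i+1} := S_i \setminus B_{i+1}$; (5) $i := i+1$. Output: $t := i$ and $B_1, B_2, \ldots, B_t$. (Thus each $S_i$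 consists of the entries $b_1, \ldots, b_{n_i}$.) *)

theory Defs
  imports "Graph_Theory.Digraph" "HOL-Library.Disjoint_Sets"
begin

(* A finite simple undirected graph is a symmetric, loop-free digraph without multiple arcs
   (the locale graph): every edge uv is the pair of opposite arcs (u,v), (v,u), so each edge
   at v contributes exactly one outgoing arc and the degree is the out-degree. *)
abbreviation degree :: "('a, 'b) pre_digraph \<Rightarrow> 'a \<Rightarrow> nat" where
  "degree G v \<equiv> out_degree G v"

definition k_large :: "nat \<Rightarrow> ('a, 'b) pre_digraph \<Rightarrow> 'a set \<Rightarrow> bool" where
  "k_large k G W \<longleftrightarrow>
     W \<subseteq> verts G \<and> (\<forall>v\<in>W. int (degree G v) \<ge> int (card W) - int k - 1)"

(* The parts of a partition are nonempty, as required by partition_on. *)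
definition Omega :: "nat \<Rightarrow> ('a, 'b) pre_digraph \<Rightarrow> nat" where
  "Omega k G = (LEAST t. \<exists>P. partition_on (verts G) P \<and> card P = t \<and> (\<forall>W\<in>P. k_large k G W))"

(* Algorithm 2 on the input b 1 \<ge> ... \<ge> b m. Since entries of a sequence are distinguished by
   their indices, a subsequence {b j | j \<in> J} is represented by its index set J; equal
   values at different positions therefore stay different entries.
   next_block b k S is the block chosen in a pass of the loop whose current state is S,
   consisting of the last q entries b n, b (n - 1), ..., b (n - q + 1). *)
definition next_block :: "(nat \<Rightarrow> nat) \<Rightarrow> nat \<Rightarrow> nat set \<Rightarrow> nat set" where
  "next_block b k S =
     (let n = card S; q = min n (b n + k + 1) in {n - q + 1..n})"

primrec alg2_S :: "(nat \<Rightarrow> nat) \<Rightarrow> nat \<Rightarrow> nat \<Rightarrow> nat \<Rightarrow> nat set" where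
  "alg2_S b k m 0 = {1..m}"
| "alg2_S b k m (Suc i) = alg2_S b k m i - next_block b k (alg2_S b k m i)"

definition alg2_t :: "(nat \<Rightarrow> nat) \<Rightarrow> nat \<Rightarrow> nat \<Rightarrow> nat" where
  "alg2_t b k m = (LEAST i. alg2_S b k m i = {})"

(* The blocks are numbered from 1: B_(i+1) is chosen from S_i. *)
definition alg2_B :: "(nat \<Rightarrow> nat) \<Rightarrow> nat \<Rightarrow> nat \<Rightarrow> nat \<Rightarrow> nat set" where
  "alg2_B b k m i = next_block b k (alg2_S b k m (i - 1))"

lemma alg2_S_initial_segment: "\<exists>r\<le>m - i. alg2_S b k m i = {1..r}"
proof (induction i)
  case 0
  show ?case by auto
next
  case (Suc i)
  then obtain r where r: "r \<le> m - i" "alg2_S b k m i = {1..r}" by blast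
  define q where "q = min r (b r + k + 1)"
  have "alg2_S b k m (Suc i) = {1..r} - {r - q + 1..r}"
    by (simp add: r next_block_def q_def Let_def)
  also have "\<dots> = {1..r - q}"
    by auto
  finally have "alg2_S b k m (Suc i) = {1..r - q}" .
  moreover have "r - q \<le> m - Suc i"
    using r(1) by (auto simp: q_def)
  ultimately show ?case by blast
qed

lemma alg2_terminates: "alg2_S b k m (alg2_t b k m) = {}"
proof -
  have "alg2_S b k m m = {}"
    using alg2_S_initial_segment[of m m b k] by auto
  then show ?thesis
    unfolding alg2_t_def by (rule LeastI)
qed

lemma Omega_attained:
  assumes "finite (verts G)"
  shows "\<exists>P. partition_on (verts G) P \<and> card P = Omega k G \<and> (\<forall>W\<in>P. k_large k G W)"
  unfolding Omega_def
proof (rule LeastI_ex)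
  let ?P = "(\<lambda>v. {v}) ` verts G"
  have "partition_on (verts G) ?P"
    by (auto simp: partition_on_def disjoint_def)
  moreover have "\<forall>W\<in>?P. k_large k G W"
    by (auto simp: k_large_def)
  ultimately show "\<exists>t P. partition_on (verts G) P \<and> card P = t \<and> (\<forall>W\<in>P. k_large k G W)"
    by blast
qed

end

(* Algorithm 2 only remembers the number r of unassigned entries, which one pass turns into
   f r = r - (b r + k + 1). Since b is non-increasing, f is monotone. If s large sets cover a
   set A of r entries, the one containing the last entry p of A has at most
   b p + k + 1 \<le> b r + k + 1 elements because p \<ge> r, so the other s - 1 sets cover at least f r
   entries; by induction f^s r = 0, that is, the algorithm stops after at most s passes. *)
theory Submission
  imports Defs
begin

text \<open>Truncated subtraction absorbs the \<open>min\<close> in \<open>next_block\<close>. It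
  also makes 0 a fixed point whatever the default value \<open>b 0\<close> is.\<close>

definition remaining :: "(nat \<Rightarrow> nat) \<Rightarrow> nat \<Rightarrow> nat \<Rightarrow> nat" where
  "remaining b k r = r - (b r + k + 1)"

lemma remaining_le: "remaining b k r \<le> r"
  by (simp add: remaining_def)

lemma remaining_mono:
  assumes "antimono_on {1..m} b" "r \<le> s" "s \<le> m"
  shows "remaining b k r \<le> remaining b k s"
\<comment> \<open>Antitonicity of \<open>b\<close> starts at index 1, so \<open>b 0\<close> must be
  kept out of the comparison.\<close>
proof (cases "r = 0")
  case False
  then have "b s \<le> b r"
    using assms by (intro monotone_onD[OF assms(1)]) auto
  then show ?thesis
    using assms(2) by (simp add: remaining_def)
qed (simp add: remaining_def)

lemma funpow_remaining_le: "(remaining b k ^^ i) r \<le> r"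
  by (induction i) (auto intro: order_trans[OF remaining_le])

lemma funpow_remaining_mono:
  assumes "antimono_on {1..m} b" "r \<le> s" "s \<le> m"
  shows "(remaining b k ^^ i) r \<le> (remaining b k ^^ i) s"
proof (induction i)
  case (Suc i)
  then show ?case
    using remaining_mono[OF assms(1) Suc] order_trans[OF funpow_remaining_le assms(3)] by simp
qed (use assms in auto)

lemma next_block_atLeastAtMost: "next_block b k {1..r} = {remaining b k r + 1..r}"
  by (auto simp: next_block_def remaining_def Let_def)

lemma next_block_atLeastAtMost_nonempty: "0 < r \<Longrightarrow> next_block b k {1..r} \<noteq> {}"
  unfolding next_block_atLeastAtMost by (simp add: remaining_def)

lemma alg2_S_eq: "alg2_S b k m i = {1..(remaining b k ^^ i) m}"
proof (induction i)
  case (Suc i)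
  then show ?case
    using next_block_atLeastAtMost[of b k "(remaining b k ^^ i) m"]
      remaining_le[of b k "(remaining b k ^^ i) m"] by auto
qed simp

lemma alg2_S_antimono: "i \<le> j \<Longrightarrow> alg2_S b k m j \<subseteq> alg2_S b k m i"
  by (rule lift_Suc_antimono_le[of "alg2_S b k m"]) auto

lemma alg2_B_Suc_subset: "alg2_B b k m (Suc i) \<subseteq> alg2_S b k m i"
  unfolding alg2_B_def diff_Suc_1 alg2_S_eq next_block_atLeastAtMost by auto

text \<open>For \<open>i < j\<close>, block \<open>j\<close> is taken from a state contained in
  \<open>alg2_S b k m i\<close>, and block \<open>i\<close> was removed to form that state.\<close>

lemma disjoint_family_on_alg2_B: "disjoint_family_on (alg2_B b k m) {1..s}"
proof -
  have "alg2_B b k m i \<inter> alg2_B b k m j = {}" if "1 \<le> i" "i < j" for i j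
  proof -
    obtain i' where i': "i = Suc i'" using \<open>1 \<le> i\<close> by (cases i) auto
    obtain j' where j': "j = Suc j'" using \<open>i < j\<close> by (cases j) auto
    have "alg2_B b k m j \<subseteq> alg2_S b k m i"
      using alg2_B_Suc_subset[of b k m j'] alg2_S_antimono[of i j' b k m] that(2) j' by auto
    then show ?thesis
      by (auto simp: i' alg2_B_def)
  qed
  then show ?thesis
    unfolding disjoint_family_on_def by (metis Int_commute atLeastAtMost_iff nat_neq_iff)
qed

text \<open>Loop invariant: each pass moves one block out of the current state. At
  \<open>s = alg2_t b k m\<close> the state is empty, so the blocks cover everything.\<close>

lemma UN_alg2_B: "(\<Union>i\<in>{1..s}. alg2_B b k m i) \<union> alg2_S b k m s = {1..m}"
proof (induction s)
  case (Suc s)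
  then show ?case
    using alg2_B_Suc_subset[of b k m s]
    by (auto simp: atLeastAtMostSuc_conv alg2_B_def)
qed simp

text \<open>By minimality of \<open>alg2_t\<close> the state before each counted pass is nonempty,
  and every such pass takes at least one entry since \<open>b r + k + 1\<close> is positive.\<close>

lemma alg2_B_nonempty:
  assumes "i \<in> {1..alg2_t b k m}"
  shows "alg2_B b k m i \<noteq> {}"
proof -
  have "alg2_S b k m (i - 1) \<noteq> {}"
    using assms unfolding alg2_t_def by (intro not_less_Least) auto
  then have "0 < (remaining b k ^^ (i - 1)) m"
    by (simp add: alg2_S_eq)
  then show ?thesis
    unfolding alg2_B_def alg2_S_eq by (rule next_block_atLeastAtMost_nonempty)
qed

text \<open>The block size is limited through its last index \<open>r\<close>, where
  \<open>b\<close> is smallest on the block; hence the limit holds at every \<open>j\<close> in it.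
  This gives \<open>k\<close>-largeness of the output.\<close>

lemma card_alg2_B_le:
  assumes "antimono_on {1..m} b" "j \<in> alg2_B b k m i"
  shows "card (alg2_B b k m i) \<le> b j + k + 1"
proof -
  define r where "r = (remaining b k ^^ (i - 1)) m"
  have B: "alg2_B b k m i = {remaining b k r + 1..r}"
    unfolding alg2_B_def alg2_S_eq r_def next_block_atLeastAtMost ..
  have "r \<le> m"
    unfolding r_def by (rule funpow_remaining_le)
  moreover have "1 \<le> j" "j \<le> r"
    using assms(2) by (auto simp: B)
  ultimately have "b r \<le> b j"
    by (intro monotone_onD[OF assms(1)]) auto
  then show ?thesis
    by (simp add: B) (simp add: remaining_def)
qed

text \<open>The induction needs arbitrary \<open>A\<close>, because removing one set of the cover
  from an initial segment need not leave an initial segment. Finiteness of \<open>W\<close>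
  accompanies the bound because an infinite set has \<open>card\<close> 0.\<close>

lemma funpow_remaining_card_cover:
  assumes b: "antimono_on {1..m} b"
    and "finite Q" "A \<subseteq> {1..m}" "A \<subseteq> \<Union>Q"
    and "\<And>W j. W \<in> Q \<Longrightarrow> j \<in> W \<Longrightarrow> finite W \<and> card W \<le> b j + k + 1"
  shows "(remaining b k ^^ card Q) (card A) = 0"
  using assms(2-)
proof (induction "card Q" arbitrary: Q A)
  case 0
  then show ?case by simp
next
  case (Suc s)
  have fin: "finite A" and cardm: "card A \<le> m"
    using Suc.prems(2) finite_subset card_mono[OF finite_atLeastAtMost Suc.prems(2)] by auto
  show ?case
  proof (cases "A = {}")
    case True
    then show ?thesis
      using funpow_remaining_le[of _ _ _ 0] by simp
  next
    case False
    define p where "p = Max A"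
    have p: "p \<in> A" using fin False by (simp add: p_def)
    have "A \<subseteq> {1..p}"
      using Suc.prems(2) fin by (auto simp: p_def)
    then have "card A \<le> p"
      using card_mono[of "{1..p}" A] by simp
    moreover have "1 \<le> card A"
      using False fin by (simp add: Suc_leI card_gt_0_iff)
    ultimately have bp: "b p \<le> b (card A)"
      using p Suc.prems(2) cardm by (intro monotone_onD[OF b]) auto
    obtain W where W: "W \<in> Q" "p \<in> W" using p Suc.prems(3) by blast
    have "card A - card W \<le> card (A - W)"
      using Suc.prems(4)[OF W] by (intro diff_card_le_card_Diff) simp
    then have le: "remaining b k (card A) \<le> card (A - W)"
      using Suc.prems(4)[OF W] bp unfolding remaining_def by linarith
    have s: "s = card (Q - {W})"
      using Suc.hyps(2) W(1) Suc.prems(1) by simp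
    have "(remaining b k ^^ s) (card (A - W)) = 0"
      unfolding s by (rule Suc.hyps(1)) (use s Suc.prems in auto)
    moreover have "card (A - W) \<le> m"
      using cardm fin by (meson Diff_subset card_mono le_trans)
    \<comment> \<open>Monotonicity carries the zero from \<open>card (A - W)\<close> down to the
      number left by one pass on \<open>card A\<close> entries.\<close>
    ultimately have "(remaining b k ^^ s) (remaining b k (card A)) = 0"
      using funpow_remaining_mono[OF b le, of s k] by simp
    then show ?thesis
      by (simp add: Suc.hyps(2)[symmetric] funpow_swap1)
  qed
qed

lemma alg2_t_le_card_cover:
  assumes "antimono_on {1..m} b" "finite Q" "{1..m} \<subseteq> \<Union>Q"
    and "\<And>W j. W \<in> Q \<Longrightarrow> j \<in> W \<Longrightarrow> finite W \<and> card W \<le> b j + k + 1"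
  shows "alg2_t b k m \<le> card Q"
proof -
  have "(remaining b k ^^ card Q) m = 0"
    using funpow_remaining_card_cover[OF assms(1,2) subset_refl assms(3,4)] by simp
  then show ?thesis
    unfolding alg2_t_def by (intro Least_le) (simp add: alg2_S_eq)
qed

text \<open>Moving \<open>k\<close> and 1 across the inequality removes the integer subtraction and
  gives the form of the index bounds above.\<close>

lemma k_large_iff:
  "k_large k G W \<longleftrightarrow> W \<subseteq> verts G \<and> (\<forall>v\<in>W. card W \<le> degree G v + k + 1)"
  by (force simp: k_large_def)

theorem corollary3p5:
  fixes G :: "('a, 'b) pre_digraph"
    and k n t :: nat
    and v :: "nat \<Rightarrow> 'a"
    and d :: "nat \<Rightarrow> nat"
    and V :: "nat \<Rightarrow> 'a set"
  assumes "graph G"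
    and "verts G \<noteq> {}"
    and "n = card (verts G)"
    and "bij_betw v {1..n} (verts G)"
    and "\<And>j. j \<in> {1..n} \<Longrightarrow> degree G (v j) = d j"
    and "\<And>i j. 1 \<le> i \<Longrightarrow> i \<le> j \<Longrightarrow> j \<le> n \<Longrightarrow> d j \<le> d i"
    and "t = alg2_t d k n"
    and "\<And>i. i \<in> {1..t} \<Longrightarrow> V i = v ` alg2_B d k n i"
  shows "partition_on (verts G) (V ` {1..t}) \<and> inj_on V {1..t} \<and>
         (\<forall>i\<in>{1..t}. k_large k G (V i)) \<and>
         t = Omega k G"
proof -
  have b: "antimono_on {1..n} d"
    using assms(6) by (intro monotone_onI) auto
  have vinj: "inj_on v {1..n}" and vim: "v ` {1..n} = verts G"
    using assms(4) by (auto simp: bij_betw_def)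
  have fin: "finite (verts G)"
    using vim by (metis finite_atLeastAtMost finite_imageI)
  have sub: "alg2_B d k n i \<subseteq> {1..n}" if "i \<in> {1..t}" for i
    using UN_alg2_B[of d k n t] that by blast
  have ne: "V i \<noteq> {}" if "i \<in> {1..t}" for i
    using alg2_B_nonempty[of i d k n] that assms(7,8) by simp
  have UN: "\<Union>(V ` {1..t}) = verts G"
    using UN_alg2_B[of d k n t] alg2_terminates[of d k n] assms(7,8)
    by (simp add: vim[symmetric] image_UN[symmetric])
  have dis: "V i \<inter> V j = {}" if "i \<in> {1..t}" "j \<in> {1..t}" "i \<noteq> j" for i j
  proof -
    have "alg2_B d k n i \<inter> alg2_B d k n j = {}"
      using disjoint_family_onD[OF disjoint_family_on_alg2_B] that by blast
    then show ?thesis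
      using inj_on_image_Int[OF vinj sub[OF that(1)] sub[OF that(2)]] assms(8) that by simp
  qed
  \<comment> \<open>Two equal parts with different indices would be disjoint from themselves, hence
    empty. Injectivity makes the number of parts exactly \<open>t\<close>.\<close>
  have inj: "inj_on V {1..t}"
    using dis ne by (metis inf.idem inj_onI)
  have part: "partition_on (verts G) (V ` {1..t})"
  proof (rule partition_onI)
    show "disjnt W W'" if "W \<in> V ` {1..t}" "W' \<in> V ` {1..t}" "W \<noteq> W'" for W W'
      using that dis unfolding disjnt_def by blast
  qed (use UN ne in blast)+
  have large: "k_large k G (V i)" if i: "i \<in> {1..t}" for i
  proof -
    have "card (V i) = card (alg2_B d k n i)"
      using assms(8)[OF i] card_image inj_on_subset[OF vinj sub[OF i]] by metis
    moreover have "V i \<subseteq> verts G"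
      using UN i by blast
    moreover have "degree G (v j) = d j" if "j \<in> alg2_B d k n i" for j
      using assms(5) sub[OF i] that by blast
    ultimately show ?thesis
      using assms(8)[OF i] card_alg2_B_le[OF b] by (auto simp: k_large_iff)
  qed
  have "Omega k G \<le> card (V ` {1..t})"
    unfolding Omega_def using part large by (intro Least_le) auto
  then have ge: "Omega k G \<le> t"
    using card_image[OF inj] by simp
  have "t \<le> Omega k G"
  proof -
    obtain P where P: "partition_on (verts G) P" "card P = Omega k G"
      "\<forall>W\<in>P. k_large k G W"
      using Omega_attained[OF fin] by blast
    \<comment> \<open>Pulling an optimal partition back along \<open>v\<close> turns its parts into
      index sets, to which the lower bound for covers applies.\<close>
    define pos where "pos W = {j \<in> {1..n}. v j \<in> W}" for W
    have "finite P"
      using P(1) fin by (rule finite_elements[rotated])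
    have "card (pos W) \<le> d j + k + 1" if "W \<in> P" "j \<in> pos W" for W j
    proof -
      have W: "W \<subseteq> verts G" "card W \<le> degree G (v j) + k + 1"
        using P(3) that by (auto simp: k_large_iff pos_def)
      have "card (pos W) \<le> card W"
        using finite_subset[OF W(1) fin]
        by (intro card_inj_on_le[of v] inj_on_subset[OF vinj]) (auto simp: pos_def)
      then show ?thesis
        using W(2) assms(5)[of j] that(2) by (simp add: pos_def)
    qed
    moreover have "{1..n} \<subseteq> \<Union>(pos ` P)"
    proof
      fix j assume j: "j \<in> {1..n}"
      then have "v j \<in> \<Union>P"
        using partition_onD1[OF P(1)] vim by blast
      then show "j \<in> \<Union>(pos ` P)"
        using j by (auto simp: pos_def)
    qed
    ultimately have "t \<le> card (pos ` P)"
      unfolding assms(7) using \<open>finite P\<close>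
      by (intro alg2_t_le_card_cover[OF b]) (auto simp: pos_def)
    also have "\<dots> \<le> card P"
      using \<open>finite P\<close> by (rule card_image_le)
    finally show ?thesis
      by (simp add: P(2))
  qed
  then show ?thesis
    using part inj large ge by simp
qed

end
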